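(* Let $X$ be a finite totally ordered domain. There exists an $(\varepsilon,\delta)$-differentially private algorithm that solves the interior point problem on $X$ with success probability $9/10$ and sample complexity $$n=\tilde{O}\left(\frac{1}{\varepsilon}\cdot\log\left(\frac{1}{\delta}\right)\cdot\left(\log^*|X|\right)^2\right).$$
   Context: A database is a finite multiset (tuple) $S\in X^n$ of elements of $X$. Two databases are neighboring if they differ in a single entry. A randomized algorithm $\mathcal A$ is $(\varepsilon,\delta)$-differentially private if for every two neighboring databases $S,S'$ and every event $T$, $\Pr[\mathcal A(S)\in T]\le e^{\varepsilon}\Pr[\mathcal A(S')\in T]+\delta$. An algorithm $\mathcal A$ solves the interior point problem over $X$ with sample complexity $n$ and failure probability $\beta$ (success probability $1-\beta$) if for every database $S\in X^n$, $\Pr[\min S\le \mathcal A(S)\le \max S]\ge 1-\beta$, the probability being over the coins of $\mathcal A$; the output need not be an element of $S$. $\log^*$ denotes the iterated logarithm, and $\tilde O(\cdot)$ hides polylogarithmic factors. *)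

theory Defs
  imports "HOL-Probability.Probability" "HOL-Library.Landau_Symbols"
begin

definition databases :: "'a set \<Rightarrow> nat \<Rightarrow> 'a list set" where
  "databases X n = {S. length S = n \<and> set S \<subseteq> X}"

definition neighboring :: "'a list \<Rightarrow> 'a list \<Rightarrow> bool" where
  "neighboring S S' \<longleftrightarrow> length S = length S' \<and> card {i. i < length S \<and> S ! i \<noteq> S' ! i} = 1"

text \<open>
  A randomized algorithm maps a database to the distribution of its output. The output
  ranges over the finite domain \<open>X\<close>, so discrete distributions lose no generality.
\<close>

definition randomized_algorithm :: "'a set \<Rightarrow> nat \<Rightarrow> ('a list \<Rightarrow> 'a pmf) \<Rightarrow> bool" where
  "randomized_algorithm X n \<A> \<longleftrightarrow> (\<forall>S\<in>databases X n. set_pmf (\<A> S) \<subseteq> X)"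

definition differentially_private ::
    "'a set \<Rightarrow> nat \<Rightarrow> real \<Rightarrow> real \<Rightarrow> ('a list \<Rightarrow> 'b pmf) \<Rightarrow> bool" where
  "differentially_private X n \<epsilon> \<delta> \<A> \<longleftrightarrow>
     (\<forall>S\<in>databases X n. \<forall>S'\<in>databases X n. neighboring S S' \<longrightarrow>
        (\<forall>T. measure_pmf.prob (\<A> S) T \<le> exp \<epsilon> * measure_pmf.prob (\<A> S') T + \<delta>))"

text \<open>
  Here \<open>\<beta>\<close> is the failure probability. The notion is meant for \<open>n > 0\<close> only, since
  the empty database has no minimum and maximum.
\<close>

definition solves_interior_point ::
    "'a::linorder set \<Rightarrow> nat \<Rightarrow> real \<Rightarrow> ('a list \<Rightarrow> 'a pmf) \<Rightarrow> bool" where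
  "solves_interior_point X n \<beta> \<A> \<longleftrightarrow>
     (\<forall>S\<in>databases X n.
        measure_pmf.prob (\<A> S) {y. Min (set S) \<le> y \<and> y \<le> Max (set S)} \<ge> 1 - \<beta>)"

text \<open>Iterated base-2 logarithm; the value is \<open>0\<close> for \<open>x \<le> 1\<close>.\<close>

definition log_star :: "real \<Rightarrow> nat" where
  "log_star x = (LEAST k. (log 2 ^^ k) x \<le> 1)"

text \<open>
  \<open>soft_O P g\<close> consists of the functions that are \<open>O(g polylog g)\<close> uniformly over the whole
  parameter set \<open>P\<close>: membership in the Landau set over \<open>principal P\<close> says that one constant
  works for all \<open>p \<in> P\<close>, and the exponent \<open>k\<close> does not depend on \<open>p\<close> either. As no limit
  is taken, \<open>g\<close> is truncated from below at 1 (and the logarithm shifted accordingly) in order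
  to make the bound meaningful where \<open>g\<close> is close to 0.
\<close>

definition soft_O :: "'p set \<Rightarrow> ('p \<Rightarrow> real) \<Rightarrow> ('p \<Rightarrow> real) set" where
  "soft_O P g = (\<Union>k::nat. O[principal P](\<lambda>p. max 1 (g p) * (1 + ln (max 1 (g p))) ^ k))"

end

theory Submission
  imports Defs
begin

text \<open>
  Work over the natural numbers with dyadic blocks \<open>{b 2^h ..< (b + 1) 2^h}\<close>. Insert the
  database entries one by one and replace each \<open>x\<close> by the least height \<open>h\<close> at which the block
  of \<open>x\<close> already contains \<open>t\<close> entries (the first \<open>t\<close> entries are lost). The number of
  heights at most \<open>h\<close> is the sum of \<open>max 0 (w - t)\<close> over the block weights \<open>w\<close> at height
  \<open>h\<close>, so the resulting multiset does not depend on the order of insertion. Inserting the entry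
  in which two neighbouring databases differ last therefore shows that this deterministic map
  sends neighbours to neighbours, while it shrinks the domain logarithmically and costs only
  \<open>t\<close> entries. Removing the \<open>r\<close> largest heights also preserves neighbours.

  Given an interior point \<open>z\<close> of the remaining heights, some block at height \<open>z\<close> is heavy
  while every block at height \<open>z - 1\<close> misses at least \<open>r\<close> entries. Hence one of the three
  multiples of \<open>2^(z - 1)\<close> in or at the end of the heavy block has many entries on both sides, and
  an exponential mechanism restricted to multiples near the data finds it. With \<open>K\<close> levels of
  recursion, each run with privacy parameters divided by \<open>K + 1\<close>, basic composition gives a
  sample size of order \<open>K\<^sup>2\<close>, up to logarithms.
\<close>

section \<open>Reduction to dyadic heights\<close>

definition block_count :: "nat \<Rightarrow> nat \<Rightarrow> nat multiset \<Rightarrow> nat" where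
  "block_count h b M = size {#x \<in># M. x div 2 ^ h = b#}"

text \<open>The head of the list is the entry inserted last, and its height is measured against the
  tail alone. The length test ensures that some height qualifies, so \<open>LEAST\<close> never
  ranges over an empty set.\<close>

fun heights :: "nat \<Rightarrow> nat list \<Rightarrow> nat list" where
  "heights t [] = []"
| "heights t (x # xs) = (if length xs < t then heights t xs
     else (LEAST h. t \<le> block_count h (x div 2 ^ h) (mset xs)) # heights t xs)"

lemma size_filter_mset_mono:
  assumes "\<And>x. x \<in># M \<Longrightarrow> P x \<Longrightarrow> Q x"
  shows "size (filter_mset P M) \<le> size (filter_mset Q M)"
proof -
  have "filter_mset P M = filter_mset P (filter_mset Q M)"
    using assms by (auto simp: filter_filter_mset intro!: filter_mset_cong)
  then show ?thesis by (metis size_filter_mset_lesseq)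
qed

lemma size_filter_mset_split:
  "size (filter_mset P M) + size (filter_mset (\<lambda>x. \<not> P x) M) = size M"
  by (metis multiset_partition size_union)

lemma block_count_mono:
  assumes "h \<le> h'"
  shows "block_count h (x div 2 ^ h) M \<le> block_count h' (x div 2 ^ h') M"
  unfolding block_count_def
proof (rule size_filter_mset_mono)
  fix y assume "y div 2 ^ h = x div 2 ^ h"
  then have "y div 2 ^ h div 2 ^ (h' - h) = x div 2 ^ h div 2 ^ (h' - h)" by simp
  then show "y div 2 ^ h' = x div 2 ^ h'"
    using assms by (simp flip: div_mult2_eq power_add)
qed

lemma block_count_top:
  assumes "x < 2 ^ d" "\<And>y. y \<in># M \<Longrightarrow> y < 2 ^ d"
  shows "block_count d (x div 2 ^ d) M = size M"
proof -
  have "{#y \<in># M. y div 2 ^ d = x div 2 ^ d#} = M"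
    using assms by (intro filter_mset_eq_conv[THEN iffD2]) auto
  then show ?thesis by (simp add: block_count_def)
qed

text \<open>Blocks are nested, so the qualifying heights are upward closed; some height qualifies
  because a large enough block contains \<open>x\<close> and all of \<open>M\<close>.\<close>

lemma Least_height_le_iff:
  assumes "t \<le> size M"
  shows "(LEAST h. t \<le> block_count h (x div 2 ^ h) M) \<le> h \<longleftrightarrow> t \<le> block_count h (x div 2 ^ h) M"
proof
  let ?P = "\<lambda>h. t \<le> block_count h (x div 2 ^ h) M"
  define d where "d = Max (insert x (set_mset M))"
  have "y < 2 ^ d" if "y \<in> insert x (set_mset M)" for y
    using that less_exp[of d] Max_ge[of "insert x (set_mset M)" y] unfolding d_def
    by (meson finite_insert finite_set_mset less_le_trans not_less)
  then have "?P d" using block_count_top[of x d M] assms by simp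
  then have "?P (LEAST h. ?P h)" by (rule LeastI)
  then show "(LEAST h. ?P h) \<le> h \<Longrightarrow> ?P h" using block_count_mono order_trans by blast
qed (rule Least_le)

text \<open>Inserting \<open>x\<close> raises the weight \<open>w\<close> of its block at height
  \<open>h\<close> by one. The truncated difference \<open>w - t\<close> then grows exactly if
  \<open>w\<close> was already at least \<open>t\<close>, which is when the height recorded for
  \<open>x\<close> is at most \<open>h\<close>. Unoccupied blocks in \<open>B\<close> contribute
  zero.\<close>

lemma size_heights_le:
  assumes "finite B" "\<And>x. x \<in> set xs \<Longrightarrow> x div 2 ^ h \<in> B"
  shows "size {#y \<in># mset (heights t xs). y \<le> h#} = (\<Sum>b\<in>B. block_count h b (mset xs) - t)"
  using assms(2)
proof (induction xs)
  case Nil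
  then show ?case by (simp add: block_count_def)
next
  case (Cons x xs)
  let ?b = "x div 2 ^ h"
  let ?w = "\<lambda>b. block_count h b (mset xs)"
  have bB: "?b \<in> B" using Cons.prems by simp
  have w: "block_count h b (mset (x # xs)) = (if b = ?b then Suc (?w b) else ?w b)" for b
    by (auto simp: block_count_def)
  have "(\<Sum>b\<in>B. block_count h b (mset (x # xs)) - t)
      = (Suc (?w ?b) - t) + (\<Sum>b\<in>B - {?b}. ?w b - t)"
    using assms(1) bB unfolding w by (subst sum.remove[of _ ?b]) auto
  also have "\<dots> = (if t \<le> ?w ?b then 1 else 0) + (\<Sum>b\<in>B. ?w b - t)"
    using assms(1) bB by (subst (2) sum.remove[of _ ?b]) auto
  also have "\<dots> = size {#y \<in># mset (heights t (x # xs)). y \<le> h#}"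
  proof (cases "length xs < t")
    \<comment> \<open>With fewer than \<open>t\<close> entries no block has weight \<open>t\<close>:
      no height is recorded and the sum does not grow.\<close>
    case True
    have "?w ?b \<le> length xs"
      unfolding block_count_def by (metis size_filter_mset_lesseq size_mset)
    then show ?thesis using Cons True by auto
  next
    case False
    then show ?thesis using Cons Least_height_le_iff[of t "mset xs" x h] by auto
  qed
  finally show ?case by simp
qed

text \<open>The count of \<open>h\<close> is a difference of consecutive cumulative counts;
  \<open>h = 0\<close> is separate because \<open>0 - 1 = 0\<close> on naturals.\<close>

lemma multiset_eqI_cumulative:
  fixes M N :: "nat multiset"
  assumes "\<And>h. size {#y \<in># M. y \<le> h#} = size {#y \<in># N. y \<le> h#}"
  shows "M = N"
proof (rule multiset_eqI)
  fix h
  have *: "count L h + (if h = 0 then 0 else size {#y \<in># L. y \<le> h - 1#}) = size {#y \<in># L. y \<le> h#}"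
    for L :: "nat multiset"
    by (induction L) (auto split: if_splits)
  show "count M h = count N h" using *[of M] *[of N] assms by (metis add_right_cancel)
qed

lemma mset_heights_cong:
  assumes "mset xs = mset ys"
  shows "mset (heights t xs) = mset (heights t ys)"
proof (rule multiset_eqI_cumulative)
  fix h
  let ?B = "(\<lambda>x. x div 2 ^ h) ` set xs"
  have "set xs = set ys" using assms by (metis set_mset_mset)
  then show "size {#y \<in># mset (heights t xs). y \<le> h#} = size {#y \<in># mset (heights t ys). y \<le> h#}"
    using size_heights_le[of ?B xs h t] size_heights_le[of ?B ys h t] assms by simp
qed

lemma length_heights: "length (heights t xs) = length xs - t"
  by (induction xs) auto

lemma heights_le:
  assumes "\<And>x. x \<in> set xs \<Longrightarrow> x < 2 ^ d" "y \<in> set (heights t xs)"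
  shows "y \<le> d"
  using assms
proof (induction xs)
  case (Cons x xs)
  show ?case
  proof (cases "y \<in> set (heights t xs)")
    case False
    then have "t \<le> length xs" "y = (LEAST h. t \<le> block_count h (x div 2 ^ h) (mset xs))"
      using Cons.prems by (auto split: if_splits)
    then show ?thesis
      using Cons.prems Least_height_le_iff[of t "mset xs" x d] block_count_top[of x d "mset xs"] by auto
  qed (use Cons in auto)
qed simp

section \<open>Condensed multisets and their block structure\<close>

text \<open>A multiset has no order, so its sorted enumeration is used;
  \<open>mset_heights_cong\<close> makes this choice harmless. Of the \<open>size M - t\<close>
  heights, the prefix of the sorted list drops the \<open>r\<close> largest.\<close>

definition condense :: "nat \<Rightarrow> nat \<Rightarrow> nat multiset \<Rightarrow> nat multiset" where
  "condense t r M = mset (take (size M - t - r) (sort (heights t (sorted_list_of_multiset M))))"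

text \<open>The longer prefix gains \<open>x\<close> if \<open>x\<close> lands inside it, and
  otherwise the element of \<open>l\<close> at position \<open>k\<close>.\<close>

lemma mset_take_insort:
  "k \<le> length l \<Longrightarrow> \<exists>y. mset (take (Suc k) (insort x l)) = add_mset y (mset (take k l))"
proof (induction l arbitrary: k)
  case (Cons a l)
  show ?case
  proof (cases "x \<le> a")
    case False
    show ?thesis
    proof (cases k)
      case (Suc j)
      then obtain y where "mset (take (Suc j) (insort x l)) = add_mset y (mset (take j l))"
        using Cons.IH[of j] Cons.prems by auto
      then show ?thesis using False Suc by (auto intro: add_mset_commute)
    qed (use False in auto)
  qed auto
qed simp

text \<open>By order independence \<open>x\<close> may be inserted last, which adds a single height
  to those of \<open>C\<close>. Neighbours share \<open>C\<close>, so their images share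
  \<open>condense t r C\<close> and differ in one element.\<close>

lemma condense_add_mset:
  assumes "t + r \<le> size C"
  shows "\<exists>y. condense t r (add_mset x C) = add_mset y (condense t r C)"
proof -
  let ?l = "sorted_list_of_multiset C"
  let ?h = "LEAST h. t \<le> block_count h (x div 2 ^ h) C"
  have len: "length ?l = size C" by (metis mset_sorted_list_of_multiset size_mset)
  have "mset (heights t (sorted_list_of_multiset (add_mset x C))) = mset (heights t (x # ?l))"
    by (rule mset_heights_cong) (simp add: mset_sorted_list_of_multiset del: sorted_list_of_multiset_insert)
  also have "heights t (x # ?l) = ?h # heights t ?l" using assms len by simp
  finally have "sort (heights t (sorted_list_of_multiset (add_mset x C))) = insort ?h (sort (heights t ?l))"
    by (intro properties_for_sort) (simp_all add: sorted_insort)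
  then show ?thesis
    using assms mset_take_insort[of "size C - t - r" "sort (heights t ?l)" ?h]
    by (auto simp: condense_def length_heights len Suc_diff_le)
qed

lemma size_condense: "size (condense t r M) = size M - t - r"
proof -
  have "length (sorted_list_of_multiset M) = size M" by (metis mset_sorted_list_of_multiset size_mset)
  then show ?thesis by (simp add: condense_def length_heights)
qed

lemma condense_le:
  assumes "\<And>x. x \<in># M \<Longrightarrow> x < 2 ^ d" "y \<in># condense t r M"
  shows "y \<le> d"
  using assms heights_le[of "sorted_list_of_multiset M" d y t]
  by (auto simp: condense_def dest!: in_set_takeD)

text \<open>If no block at height \<open>h\<close> exceeded \<open>t\<close>, the counting formula
  would give zero heights up to \<open>h\<close>.\<close>

lemma exists_heavy_block:
  assumes "z \<in># condense t r M" "z \<le> h"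
  shows "\<exists>b. t < block_count h b M"
proof (rule ccontr)
  assume "\<not> ?thesis"
  then have "size {#y \<in># mset (heights t (sorted_list_of_multiset M)). y \<le> h#} = 0"
    by (subst size_heights_le[of "(\<lambda>x. x div 2 ^ h) ` set_mset M"]) (auto simp: mset_sorted_list_of_multiset not_less)
  then have "\<not> z \<in> set (heights t (sorted_list_of_multiset M))" using assms by auto
  then show False using assms(1) by (auto simp: condense_def dest!: in_set_takeD)
qed

text \<open>The surviving \<open>z\<close> exceeds \<open>h\<close>, so all heights up to
  \<open>h\<close> lie in the kept prefix and number at most \<open>size M - t - r\<close>. The
  counting formula attributes \<open>block_count h b M - t\<close> of them to the block
  \<open>b\<close>.\<close>

lemma block_count_bound:
  assumes "t + r \<le> size M" "z \<in># condense t r M" "h < z"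
  shows "block_count h b M + r \<le> size M"
proof (cases "block_count h b M \<le> t")
  case False
  let ?l = "sort (heights t (sorted_list_of_multiset M))" and ?k = "size M - t - r"
  have len: "length (sorted_list_of_multiset M) = size M" by (metis mset_sorted_list_of_multiset size_mset)
  let ?B = "insert b ((\<lambda>x. x div 2 ^ h) ` set_mset M)"
  have "block_count h b M - t \<le> (\<Sum>b\<in>?B. block_count h b M - t)"
    by (rule member_le_sum) auto
  also have "\<dots> = size {#y \<in># mset (heights t (sorted_list_of_multiset M)). y \<le> h#}"
    by (subst size_heights_le[of ?B]) (auto simp: mset_sorted_list_of_multiset)
  also have "\<dots> = length (filter (\<lambda>y. y \<le> h) ?l)"
    by (metis mset_filter mset_sort size_mset)
  also have "\<dots> \<le> ?k"
  proof -
    obtain i where i: "i < length ?l" "i < ?k" "?l ! i = z"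
      using assms(2) by (auto simp: condense_def in_set_conv_nth)
    \<comment> \<open>The discarded heights come after \<open>z\<close> in sorted order, hence
      exceed \<open>h\<close>.\<close>
    have "filter (\<lambda>y. y \<le> h) (drop ?k ?l) = []"
    proof -
      have "z \<le> y" if y: "y \<in> set (drop ?k ?l)" for y
      proof -
        obtain j where "j < length (drop ?k ?l)" "drop ?k ?l ! j = y" using y by (auto simp: in_set_conv_nth)
        then have "y = ?l ! (?k + j)" "?k + j < length ?l" by auto
        then show ?thesis using i sorted_nth_mono[of ?l i "?k + j"] by simp
      qed
      then show ?thesis using assms(3) by (fastforce simp: filter_empty_conv)
    qed
    then have "filter (\<lambda>y. y \<le> h) ?l = filter (\<lambda>y. y \<le> h) (take ?k ?l)"
      by (metis append_Nil2 append_take_drop_id filter_append)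
    then show ?thesis by (metis length_filter_le length_take min.cobounded2 order_trans)
  qed
  finally show ?thesis using False assms(1) by linarith
qed (use assms(1) in linarith)

section \<open>Composition and the exponential mechanism\<close>

text \<open>Passes from events to test functions; in a composition the test function bounds the
  probability of the final event given the first output.\<close>

lemma integral_le_of_prob_le:
  fixes \<mu> \<nu> :: "'b pmf" and f :: "'b \<Rightarrow> real"
  assumes le: "\<And>T. measure_pmf.prob \<mu> T \<le> c * measure_pmf.prob \<nu> T + d"
    and f: "\<And>x. 0 \<le> f x" "\<And>x. f x \<le> 1" and c: "0 \<le> c"
  shows "measure_pmf.expectation \<mu> f \<le> c * measure_pmf.expectation \<nu> f + d"
proof -
  \<comment> \<open>\<open>f = indicator T\<close> is the worst case.\<close>
  define T where "T = {x. c * pmf \<nu> x < pmf \<mu> x}"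
  have integrable: "integrable (count_space UNIV) (\<lambda>x. pmf \<rho> x * g x)"
    if "\<And>x. \<bar>g x\<bar> \<le> 1" for \<rho> :: "'b pmf" and g :: "'b \<Rightarrow> real"
    by (rule Bochner_Integration.integrable_bound[OF integrable_pmf[of UNIV \<rho>]])
      (auto simp: abs_mult intro!: mult_left_le that)
  have expectation: "measure_pmf.expectation \<rho> g = (\<integral>x. pmf \<rho> x * g x \<partial>count_space UNIV)"
    for \<rho> :: "'b pmf" and g :: "'b \<Rightarrow> real"
    unfolding measure_pmf_eq_density by (subst integral_density) auto
  have prob: "measure_pmf.prob \<rho> T = (\<integral>x. pmf \<rho> x * indicator T x \<partial>count_space UNIV)" for \<rho> :: "'b pmf"
    by (simp flip: expectation)
  have "measure_pmf.expectation \<mu> f - c * measure_pmf.expectation \<nu> f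
      = (\<integral>x. pmf \<mu> x * f x - c * (pmf \<nu> x * f x) \<partial>count_space UNIV)"
    unfolding expectation using f
    by (subst Bochner_Integration.integral_diff) (auto intro!: integrable integrable_mult_right)
  also have "\<dots> \<le> (\<integral>x. pmf \<mu> x * indicator T x - c * (pmf \<nu> x * indicator T x) \<partial>count_space UNIV)"
  proof (rule integral_mono)
    fix x
    have "(pmf \<mu> x - c * pmf \<nu> x) * f x \<le> (pmf \<mu> x - c * pmf \<nu> x) * indicator T x"
    proof (cases "x \<in> T")
      case True
      then show ?thesis using f[of x] by (auto simp: T_def intro!: mult_left_le)
    next
      case False
      then show ?thesis using f[of x] by (auto simp: T_def intro: mult_nonpos_nonneg)
    qed
    then show "pmf \<mu> x * f x - c * (pmf \<nu> x * f x)
        \<le> pmf \<mu> x * indicator T x - c * (pmf \<nu> x * indicator T x)"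
      by (simp add: algebra_simps)
  qed (use f in \<open>auto intro!: integrable integrable_mult_right Bochner_Integration.integrable_diff
    simp del: Bochner_Integration.integrable_diff split: split_indicator\<close>)
  also have "\<dots> = measure_pmf.prob \<mu> T - c * measure_pmf.prob \<nu> T"
    unfolding prob
    by (subst Bochner_Integration.integral_diff) (auto intro!: integrable integrable_mult_right)
  finally show ?thesis using le[of T] by simp
qed

lemma prob_bind_pmf:
  "measure_pmf.prob (bind_pmf M f) T = measure_pmf.expectation M (\<lambda>x. measure_pmf.prob (f x) T)"
proof -
  have "ennreal (measure_pmf.prob (bind_pmf M f) T) = (\<integral>\<^sup>+x. ennreal (measure_pmf.prob (f x) T) \<partial>M)"
    by (simp flip: measure_pmf.emeasure_eq_measure)
  also have "\<dots> = ennreal (measure_pmf.expectation M (\<lambda>x. measure_pmf.prob (f x) T))"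
    by (intro nn_integral_eq_integral measure_pmf.integrable_const_bound[where B = 1]) auto
  finally show ?thesis by (simp add: integral_nonneg)
qed

text \<open>Basic composition with an adaptive second stage. Truncating the second-stage bound at 1
  makes it a legitimate test function, so \<open>d\<close> is not multiplied by
  \<open>exp b\<close>.\<close>

lemma prob_bind_le:
  fixes \<mu> \<nu> :: "'b pmf" and f g :: "'b \<Rightarrow> 'c pmf"
  assumes "\<And>T. measure_pmf.prob \<mu> T \<le> exp a * measure_pmf.prob \<nu> T + d"
    and fg: "\<And>x T. measure_pmf.prob (f x) T \<le> exp b * measure_pmf.prob (g x) T + e"
    and "0 \<le> e"
  shows "measure_pmf.prob (bind_pmf \<mu> f) T \<le> exp (a + b) * measure_pmf.prob (bind_pmf \<nu> g) T + (d + e)"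
proof -
  let ?h = "\<lambda>x. min 1 (exp b * measure_pmf.prob (g x) T)"
  have h: "0 \<le> ?h x" "?h x \<le> 1" for x by auto
  have integrable: "integrable (measure_pmf \<rho>) ?h" for \<rho>
    by (intro measure_pmf.integrable_const_bound[where B = 1]) auto
  have "measure_pmf.expectation \<mu> (\<lambda>x. measure_pmf.prob (f x) T) \<le> measure_pmf.expectation \<mu> (\<lambda>x. ?h x + e)"
  proof (rule integral_mono)
    show "integrable (measure_pmf \<mu>) (\<lambda>x. measure_pmf.prob (f x) T)"
      by (intro measure_pmf.integrable_const_bound[where B = 1]) auto
    show "measure_pmf.prob (f x) T \<le> ?h x + e" for x
      using fg[of x T] \<open>0 \<le> e\<close> measure_pmf.prob_le_1[of "f x" T] by linarith
  qed (use integrable in auto)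
  also have "\<dots> = measure_pmf.expectation \<mu> ?h + e"
    by (subst Bochner_Integration.integral_add) (auto intro: integrable)
  also have "\<dots> \<le> exp a * measure_pmf.expectation \<nu> ?h + d + e"
    using integral_le_of_prob_le[OF assms(1), of ?h] h by simp
  also have "measure_pmf.expectation \<nu> ?h \<le> measure_pmf.expectation \<nu> (\<lambda>x. exp b * measure_pmf.prob (g x) T)"
    by (intro integral_mono integrable measure_pmf.integrable_const_bound[where B = "exp b"]) (auto simp: mult_left_le)
  also have "\<dots> = exp b * measure_pmf.prob (bind_pmf \<nu> g) T"
    by (simp add: prob_bind_pmf)
  finally show ?thesis by (simp add: prob_bind_pmf exp_add mult.assoc)
qed

lemma prob_bind_ge:
  assumes "1 - a \<le> measure_pmf.prob \<mu> A" "\<And>x. x \<in> A \<Longrightarrow> 1 - b \<le> measure_pmf.prob (f x) T"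
    and "0 \<le> b" "b \<le> 1"
  shows "1 - (a + b) \<le> measure_pmf.prob (bind_pmf \<mu> f) T"
proof -
  have "0 \<le> (1 - measure_pmf.prob \<mu> A) * b" using assms by (intro mult_nonneg_nonneg) auto
  then have "1 - (a + b) \<le> measure_pmf.prob \<mu> A * (1 - b)"
    using assms(1) by (simp add: algebra_simps)
  also have "\<dots> = measure_pmf.expectation \<mu> (\<lambda>x. indicator A x * (1 - b))" by simp
  also have "\<dots> \<le> measure_pmf.expectation \<mu> (\<lambda>x. measure_pmf.prob (f x) T)"
    using assms
    by (intro integral_mono measure_pmf.integrable_const_bound[where B = 1]) (auto split: split_indicator)
  finally show ?thesis by (simp add: prob_bind_pmf)
qed

section \<open>Exponential mechanism with an extra weight at 0\<close>

text \<open>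
  The extra weight at \<open>0\<close> dominates the total weight of the candidates whose score becomes positive
  when one entry changes; their number is bounded, but they have no counterpart in the
  neighbouring database.
\<close>

definition select_weight :: "real \<Rightarrow> real \<Rightarrow> (nat \<Rightarrow> nat) \<Rightarrow> nat \<Rightarrow> real" where
  "select_weight \<epsilon> \<tau> s c = (if 0 < s c then exp (\<epsilon> * real (s c)) else 0) + (if c = 0 then exp (\<epsilon> * \<tau>) else 0)"

definition select_pmf :: "real \<Rightarrow> real \<Rightarrow> (nat \<Rightarrow> nat) \<Rightarrow> nat pmf" where
  "select_pmf \<epsilon> \<tau> s = embed_pmf (\<lambda>c. select_weight \<epsilon> \<tau> s c /
     (\<Sum>c\<in>insert 0 {c. 0 < s c}. select_weight \<epsilon> \<tau> s c))"

lemma select_weight_nonneg: "0 \<le> select_weight \<epsilon> \<tau> s c"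
  by (simp add: select_weight_def)

text \<open>Any finite superset \<open>F\<close> of the support may be used for normalising, so two
  score functions can be compared over a common \<open>F\<close>. The lower bound on the normaliser
  is the extra weight at \<open>0\<close>.\<close>

lemma prob_select:
  assumes "finite F" "insert 0 {c. 0 < s c} \<subseteq> F"
  shows "measure_pmf.prob (select_pmf \<epsilon> \<tau> s) T = (\<Sum>c\<in>F \<inter> T. select_weight \<epsilon> \<tau> s c) / (\<Sum>c\<in>F. select_weight \<epsilon> \<tau> s c)"
    and "exp (\<epsilon> * \<tau>) \<le> (\<Sum>c\<in>F. select_weight \<epsilon> \<tau> s c)"
proof -
  let ?w = "select_weight \<epsilon> \<tau> s"
  let ?Z = "\<Sum>c\<in>F. ?w c"
  have out: "?w c = 0" if "c \<notin> insert 0 {c. 0 < s c}" for c using that by (auto simp: select_weight_def)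
  have outF: "?w c = 0" if "c \<notin> F" for c using out that assms(2) by blast
  have Z: "(\<Sum>c\<in>insert 0 {c. 0 < s c}. ?w c) = ?Z"
    using assms out by (intro sum.mono_neutral_left) auto
  have "exp (\<epsilon> * \<tau>) \<le> ?w 0" by (auto simp: select_weight_def)
  also have "\<dots> \<le> ?Z" using assms by (intro member_le_sum) (auto simp: select_weight_nonneg)
  finally show Zge: "exp (\<epsilon> * \<tau>) \<le> ?Z" .
  then have Zpos: "0 < ?Z" by (meson exp_gt_zero less_le_trans)
  have pmf: "pmf (select_pmf \<epsilon> \<tau> s) c = ?w c / ?Z" for c
    unfolding select_pmf_def Z
  proof (rule pmf_embed_pmf)
    show "0 \<le> ?w c / ?Z" for c using Zpos by (simp add: select_weight_nonneg)
    have "(\<integral>\<^sup>+c. ennreal (?w c / ?Z) \<partial>count_space UNIV) = (\<Sum>c\<in>F. ennreal (?w c / ?Z))"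
      using assms(1) outF by (intro nn_integral_count_space') auto
    also have "\<dots> = ennreal (\<Sum>c\<in>F. ?w c / ?Z)"
      using Zpos by (intro sum_ennreal) (simp add: select_weight_nonneg)
    also have "\<dots> = 1" using Zpos by (simp flip: sum_divide_distrib)
    finally show "(\<integral>\<^sup>+c. ennreal (?w c / ?Z) \<partial>count_space UNIV) = 1" .
  qed
  have "pmf (select_pmf \<epsilon> \<tau> s) c = 0" if "c \<notin> F" for c using outF[OF that] by (simp add: pmf)
  then have "set_pmf (select_pmf \<epsilon> \<tau> s) \<subseteq> F" by (meson set_pmf_iff subsetI)
  then have "measure_pmf.prob (select_pmf \<epsilon> \<tau> s) T = measure_pmf.prob (select_pmf \<epsilon> \<tau> s) (F \<inter> T)"
    by (intro measure_prob_cong_0) (auto simp: set_pmf_iff)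
  also have "\<dots> = (\<Sum>c\<in>F \<inter> T. ?w c) / ?Z"
    using assms(1) by (simp add: measure_measure_pmf_finite pmf sum_divide_distrib)
  finally show "measure_pmf.prob (select_pmf \<epsilon> \<tau> s) T = (\<Sum>c\<in>F \<inter> T. ?w c) / ?Z" .
qed

text \<open>A weight grows by a factor of at most \<open>exp \<epsilon>\<close>, except where the
  score rises from 0 to 1: there \<open>exp \<epsilon>\<close> appears out of nothing, for at most
  \<open>N\<close> candidates.\<close>

lemma sum_select_weight_le:
  assumes "finite F" "finite {c. 0 < s c}" "card {c. 0 < s c} \<le> N" "0 \<le> \<epsilon>" "\<And>c. s c \<le> s' c + 1"
  shows "(\<Sum>c\<in>F. select_weight \<epsilon> \<tau> s c) \<le> exp \<epsilon> * (\<Sum>c\<in>F. select_weight \<epsilon> \<tau> s' c) + real N * exp \<epsilon>"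
proof -
  have exp1: "1 \<le> exp \<epsilon>" using assms by simp
  have "select_weight \<epsilon> \<tau> s c \<le> exp \<epsilon> * select_weight \<epsilon> \<tau> s' c + exp \<epsilon> * indicator {c. 0 < s c} c" for c
  proof -
    have "(if 0 < s c then exp (\<epsilon> * real (s c)) else 0)
      \<le> exp \<epsilon> * (if 0 < s' c then exp (\<epsilon> * real (s' c)) else 0) + exp \<epsilon> * indicator {c. 0 < s c} c"
    proof (cases "0 < s c")
      case True
      have "\<epsilon> * real (s c) \<le> \<epsilon> * (real (s' c) + 1)"
        using assms(4) assms(5)[of c] by (intro mult_left_mono) linarith+
      then have *: "exp (\<epsilon> * real (s c)) \<le> exp \<epsilon> * exp (\<epsilon> * real (s' c))"
        by (simp add: algebra_simps flip: exp_add)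
      show ?thesis
      proof (cases "0 < s' c")
        case True
        then show ?thesis using * by (auto split: split_indicator intro: add_increasing2)
      next
        case False
        then show ?thesis using * True by (auto split: split_indicator)
      qed
    qed auto
    moreover have "(if c = 0 then exp (\<epsilon> * \<tau>) else 0) \<le> exp \<epsilon> * (if c = 0 then exp (\<epsilon> * \<tau>) else 0)"
      using exp1 by simp
    ultimately show ?thesis unfolding select_weight_def distrib_left by linarith
  qed
  then have "(\<Sum>c\<in>F. select_weight \<epsilon> \<tau> s c)
      \<le> (\<Sum>c\<in>F. exp \<epsilon> * select_weight \<epsilon> \<tau> s' c + exp \<epsilon> * indicator {c. 0 < s c} c)"
    by (intro sum_mono)
  also have "\<dots> = exp \<epsilon> * (\<Sum>c\<in>F. select_weight \<epsilon> \<tau> s' c) + exp \<epsilon> * real (card (F \<inter> {c. 0 < s c}))"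
  proof -
    have "(\<Sum>c\<in>F. indicator {c. 0 < s c} c) = real (card (F \<inter> {c. 0 < s c}))"
      using assms(1) by (simp add: indicator_def of_bool_def sum.If_cases Int_def)
    then show ?thesis by (simp add: sum.distrib flip: sum_distrib_left)
  qed
  also have "real (card (F \<inter> {c. 0 < s c})) \<le> real N"
    using assms(2,3) card_mono[of "{c. 0 < s c}" "F \<inter> {c. 0 < s c}"] by simp
  finally show ?thesis by (simp add: mult.commute)
qed

text \<open>Numerator and normaliser each cost one factor \<open>exp \<epsilon>\<close>, hence
  \<open>2 * \<epsilon>\<close>. The additive errors, at most
  \<open>2 * N * exp (2 * \<epsilon>)\<close> in total, are absorbed into \<open>\<delta>\<close>
  because the normaliser is at least \<open>exp (\<epsilon> * \<tau>)\<close>.\<close>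

lemma select_private:
  assumes s: "finite {c. 0 < s c}" "card {c. 0 < s c} \<le> N" "\<And>c. s c \<le> s' c + 1"
    and s': "finite {c. 0 < s' c}" "card {c. 0 < s' c} \<le> N" "\<And>c. s' c \<le> s c + 1"
    and "0 \<le> \<epsilon>" and d: "2 * real N * exp (2 * \<epsilon>) \<le> \<delta> * exp (\<epsilon> * \<tau>)"
  shows "measure_pmf.prob (select_pmf \<epsilon> \<tau> s) T \<le> exp (2 * \<epsilon>) * measure_pmf.prob (select_pmf \<epsilon> \<tau> s') T + \<delta>"
proof -
  define F where "F = insert 0 ({c. 0 < s c} \<union> {c. 0 < s' c})"
  have F: "finite F" "insert 0 {c. 0 < s c} \<subseteq> F" "insert 0 {c. 0 < s' c} \<subseteq> F"
    using s s' by (auto simp: F_def)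
  define W where "W A = (\<Sum>c\<in>A. select_weight \<epsilon> \<tau> s c)" for A
  define W' where "W' A = (\<Sum>c\<in>A. select_weight \<epsilon> \<tau> s' c)" for A
  define E where "E = exp \<epsilon>"
  define Y where "Y = exp (\<epsilon> * \<tau>)"
  note P = prob_select(1)[OF F(1,2), of \<epsilon> \<tau> T, folded W_def] prob_select(1)[OF F(1,3), of \<epsilon> \<tau> T, folded W'_def]
  have Z: "Y \<le> W F" "Y \<le> W' F"
    using prob_select(2)[OF F(1,2)] prob_select(2)[OF F(1,3)] by (simp_all add: W_def W'_def Y_def)
  have Y: "0 < Y" and E: "1 \<le> E" using \<open>0 \<le> \<epsilon>\<close> by (simp_all add: Y_def E_def)
  have pos: "0 < W F" "0 < W' F" using Z Y by linarith+
  have le: "W (F \<inter> T) \<le> E * W' (F \<inter> T) + real N * E" "W' F \<le> E * W F + real N * E"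
    using sum_select_weight_le[of "F \<inter> T" s N \<epsilon> s' \<tau>] sum_select_weight_le[of F s' N \<epsilon> s \<tau>] assms F
    by (simp_all add: W_def W'_def E_def)
  define p where "p = W' (F \<inter> T) / W' F"
  have "p = measure_pmf.prob (select_pmf \<epsilon> \<tau> s') T" by (simp only: p_def P)
  then have p: "0 \<le> p" "p \<le> 1" by simp_all
  have d': "2 * real N * E\<^sup>2 \<le> \<delta> * Y" using d by (simp add: E_def Y_def exp_double)
  have "W (F \<inter> T) \<le> E * (p * W' F) + real N * E"
    using le(1) pos by (simp add: p_def)
  also have "\<dots> \<le> E * (p * (E * W F + real N * E)) + real N * E"
    using E p le(2) by (intro add_right_mono mult_left_mono) auto
  also have "\<dots> = E\<^sup>2 * p * W F + p * (real N * E\<^sup>2) + real N * E"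
    by (simp add: power2_eq_square algebra_simps)
  also have "\<dots> \<le> E\<^sup>2 * p * W F + 1 * (real N * E\<^sup>2) + real N * E\<^sup>2"
    using p E by (intro add_mono mult_right_mono mult_left_mono) (auto simp: power2_eq_square)
  also have "\<dots> \<le> E\<^sup>2 * p * W F + \<delta> * Y" using d' by simp
  also have "\<dots> \<le> E\<^sup>2 * p * W F + \<delta> * W F"
  proof -
    have "0 \<le> \<delta> * Y" using d' E by (meson mult_nonneg_nonneg of_nat_0_le_iff order_trans zero_le_numeral zero_le_power2)
    then have "0 \<le> \<delta>" using Y by (simp add: zero_le_mult_iff)
    then show ?thesis using Z by (simp add: mult_left_mono)
  qed
  finally have "W (F \<inter> T) / W F \<le> E\<^sup>2 * p + \<delta>"
    using pos by (simp add: field_simps)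
  then show ?thesis using P by (simp add: p_def E_def exp_double)
qed

text \<open>The only possible bad outcome is \<open>0\<close>, through its extra weight
  \<open>exp (\<epsilon> * \<tau>)\<close>, while the normaliser is at least
  \<open>exp (\<epsilon> * \<sigma>)\<close>.\<close>

lemma select_useful:
  assumes "finite {c. 0 < s c}" "\<sigma> \<le> s c" "0 < \<sigma>" "0 \<le> \<epsilon>"
  shows "1 - exp (\<epsilon> * (\<tau> - real \<sigma>)) \<le> measure_pmf.prob (select_pmf \<epsilon> \<tau> s) {c. 0 < s c}"
proof -
  let ?F = "insert 0 {c. 0 < s c}" and ?w = "select_weight \<epsilon> \<tau> s"
  let ?Z = "\<Sum>c\<in>?F. ?w c"
  have F: "finite ?F" using assms by simp
  have "exp (\<epsilon> * \<sigma>) \<le> exp (\<epsilon> * s c)" using assms by (simp add: mult_left_mono)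
  also have "\<dots> \<le> ?w c" using assms by (auto simp: select_weight_def)
  also have "\<dots> \<le> ?Z" using assms F by (intro member_le_sum) (auto simp: select_weight_nonneg)
  finally have Z: "exp (\<epsilon> * \<sigma>) \<le> ?Z" .
  then have Zpos: "0 < ?Z" by (meson exp_gt_zero less_le_trans)
  have "measure_pmf.prob (select_pmf \<epsilon> \<tau> s) (- {c. 0 < s c}) = (\<Sum>c\<in>?F \<inter> - {c. 0 < s c}. ?w c) / ?Z"
    using F by (intro prob_select(1)) auto
  also have "\<dots> \<le> exp (\<epsilon> * \<tau>) / exp (\<epsilon> * \<sigma>)"
  proof (rule frac_le)
    show "(\<Sum>c\<in>?F \<inter> - {c. 0 < s c}. ?w c) \<le> exp (\<epsilon> * \<tau>)"
      by (cases "0 < s 0") (auto simp: select_weight_def)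
  qed (use Z in auto)
  also have "\<dots> = exp (\<epsilon> * (\<tau> - \<sigma>))" by (simp add: algebra_simps flip: exp_diff)
  finally show ?thesis
    using measure_pmf.prob_compl[of "{c. 0 < s c}" "select_pmf \<epsilon> \<tau> s"] by (simp flip: Compl_eq_Diff_UNIV)
qed

section \<open>The recursive algorithm on natural numbers\<close>

text \<open>One-dimensional Tukey depth.\<close>

definition depth_score :: "nat multiset \<Rightarrow> nat \<Rightarrow> nat" where
  "depth_score M p = min (size {#x \<in># M. x \<le> p#}) (size {#x \<in># M. p \<le> x#})"

text \<open>The cutoff is \<open>domain_bound 0\<close>; it bounds the number of positive scores
  independently of the entries.\<close>

definition base_score :: "nat multiset \<Rightarrow> nat \<Rightarrow> nat" where
  "base_score M c = (if c < 16 then depth_score M c else 0)"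

text \<open>
  The second argument of \<open>min\<close> restricts the multiples of \<open>2^k\<close> with positive score to at most
  four per entry; without it their number would grow with the domain.
\<close>

definition boundary_score :: "nat \<Rightarrow> nat multiset \<Rightarrow> nat \<Rightarrow> nat" where
  "boundary_score k M c = min (depth_score M (c * 2 ^ k))
     (size {#x \<in># M. x div 2 ^ k \<le> c + 1 \<and> c \<le> x div 2 ^ k + 2#})"

text \<open>Heavy means more than \<open>\<sigma>\<close> entries, and \<open>2 * \<sigma>\<close>
  heights are dropped because two sides with fewer than \<open>\<sigma>\<close> entries each must be
  ruled out. At \<open>z = 0\<close> the truncated \<open>z - 1\<close> selects among points
  themselves.\<close>

primrec interior_point_pmf :: "real \<Rightarrow> real \<Rightarrow> nat \<Rightarrow> nat \<Rightarrow> nat multiset \<Rightarrow> nat pmf" where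
  "interior_point_pmf \<epsilon> \<tau> \<sigma> 0 M = select_pmf \<epsilon> \<tau> (base_score M)"
| "interior_point_pmf \<epsilon> \<tau> \<sigma> (Suc K) M =
     bind_pmf (interior_point_pmf \<epsilon> \<tau> \<sigma> K (condense \<sigma> (2 * \<sigma>) M))
       (\<lambda>z. map_pmf (\<lambda>c. c * 2 ^ (z - 1)) (select_pmf \<epsilon> \<tau> (boundary_score (z - 1) M)))"

definition interior_points :: "nat multiset \<Rightarrow> nat set" where
  "interior_points M = {p. (\<exists>x\<in>#M. x \<le> p) \<and> (\<exists>x\<in>#M. p \<le> x)}"

lemma size_filter_mset_pos_iff: "0 < size (filter_mset P M) \<longleftrightarrow> (\<exists>x\<in>#M. P x)"
  by (induction M) auto

lemma interior_if_depth_score: "0 < depth_score M p \<Longrightarrow> p \<in> interior_points M"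
  by (simp add: depth_score_def interior_points_def size_filter_mset_pos_iff)

lemma base_score_swap: "base_score (add_mset x C) c \<le> base_score (add_mset x' C) c + 1"
  by (auto simp: base_score_def depth_score_def)

lemma boundary_score_swap: "boundary_score k (add_mset x C) c \<le> boundary_score k (add_mset x' C) c + 1"
proof -
  have *: "min (min a b) d \<le> min (min a' b') d' + 1" if "a \<le> a' + 1" "b \<le> b' + 1" "d \<le> d' + 1"
    for a b d a' b' d' :: nat using that by linarith
  show ?thesis unfolding boundary_score_def depth_score_def by (rule *) auto
qed

text \<open>\<open>4 \<le> n\<close> makes the 16 base candidates obey the same bound as the
  boundary candidates.\<close>

lemma base_score_support:
  assumes "4 \<le> n"
  shows "finite {c. 0 < base_score M c}" "card {c. 0 < base_score M c} \<le> 4 * n"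
proof -
  have sub: "{c. 0 < base_score M c} \<subseteq> {..<16}" by (auto simp: base_score_def split: if_splits)
  then show "finite {c. 0 < base_score M c}" by (rule finite_subset) simp
  show "card {c. 0 < base_score M c} \<le> 4 * n" using card_mono[OF _ sub] assms by simp
qed

lemma boundary_score_support:
  assumes "size M \<le> n"
  shows "finite {c. 0 < boundary_score k M c}" "card {c. 0 < boundary_score k M c} \<le> 4 * n"
proof -
  let ?U = "\<Union>x\<in>set_mset M. {x div 2 ^ k - 1..x div 2 ^ k + 2}"
  have sub: "{c. 0 < boundary_score k M c} \<subseteq> ?U"
  proof
    fix c assume "c \<in> {c. 0 < boundary_score k M c}"
    then have "0 < size {#x \<in># M. x div 2 ^ k \<le> c + 1 \<and> c \<le> x div 2 ^ k + 2#}"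
      by (simp add: boundary_score_def)
    then obtain x where "x \<in># M" "x div 2 ^ k \<le> c + 1" "c \<le> x div 2 ^ k + 2"
      unfolding size_filter_mset_pos_iff by blast
    then show "c \<in> ?U" by (intro UN_I[of x]) auto
  qed
  then show "finite {c. 0 < boundary_score k M c}" by (rule finite_subset) simp
  have "card {c. 0 < boundary_score k M c} \<le> card ?U" using sub by (intro card_mono) auto
  also have "\<dots> \<le> (\<Sum>x\<in>set_mset M. card {x div 2 ^ k - 1..x div 2 ^ k + 2})" by (intro card_UN_le) simp
  also have "\<dots> \<le> (\<Sum>x\<in>set_mset M. 4)" by (intro sum_mono) simp
  also have "\<dots> = 4 * card (set_mset M)" by simp
  also have "card (set_mset M) \<le> n"
  proof -
    have "card (set_mset M) \<le> size M"
      by (metis card_length mset_sorted_list_of_multiset set_mset_mset size_mset)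
    then show ?thesis using assms by simp
  qed
  finally show "card {c. 0 < boundary_score k M c} \<le> 4 * n" by simp
qed

text \<open>Let \<open>p\<close> be least with \<open>\<sigma>\<close> entries at or below it. Fewer
  than \<open>\<sigma>\<close> entries lie strictly below \<open>p\<close>, so of
  \<open>2 * \<sigma>\<close> entries at least \<open>\<sigma>\<close> lie at or above it.\<close>

lemma base_score_useful:
  assumes "2 * \<sigma> \<le> size M" "0 < \<sigma>" "\<And>x. x \<in># M \<Longrightarrow> x < 16"
  shows "\<exists>c. \<sigma> \<le> base_score M c"
proof -
  let ?P = "\<lambda>p. \<sigma> \<le> size {#x \<in># M. x \<le> p#}"
  define p where "p = (LEAST p. ?P p)"
  have "{#x \<in># M. x \<le> 15#} = M" using assms(3) by (intro filter_mset_eq_conv[THEN iffD2]) fastforce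
  then have P15: "?P 15" using assms(1) by simp
  have p: "?P p" "p \<le> 15" unfolding p_def by (rule LeastI[of ?P, OF P15], rule Least_le[of ?P, OF P15])
  have "size {#x \<in># M. \<not> p \<le> x#} < \<sigma>"
  proof (cases p)
    case 0
    then show ?thesis using assms(2) by simp
  next
    case (Suc q)
    then have "\<not> ?P q" unfolding p_def using not_less_Least lessI by metis
    then show ?thesis by (simp add: Suc not_le less_Suc_eq_le)
  qed
  then have "\<sigma> \<le> size {#x \<in># M. p \<le> x#}"
    using size_filter_mset_split[of "\<lambda>x. p \<le> x" M] assms(1) by linarith
  then show ?thesis using p by (intro exI[of _ p]) (simp add: base_score_def depth_score_def)
qed

lemma boundary_score_useful:
  assumes size: "3 * \<sigma> \<le> size M" and z: "z \<in># condense \<sigma> (2 * \<sigma>) M" "z' \<in># condense \<sigma> (2 * \<sigma>) M" "z \<le> h" "h \<le> z'"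
  shows "\<exists>c. \<sigma> \<le> boundary_score (h - 1) M c"
proof -
  obtain b where "\<sigma> < block_count h b M" using exists_heavy_block[OF z(1,3)] by blast
  then have b: "\<sigma> < size {#x \<in># M. x div 2 ^ h = b#}" by (simp add: block_count_def)
  show ?thesis
  proof (cases h)
    case 0
    \<comment> \<open>At height 0 a block is a single point, so more than \<open>\<sigma>\<close>
      copies of \<open>b\<close> lie on both sides of \<open>b\<close>.\<close>
    have "\<sigma> \<le> boundary_score 0 M b" unfolding boundary_score_def depth_score_def min.bounded_iff
      by (intro conjI order_trans[OF less_imp_le[OF b]] size_filter_mset_mono) (auto simp: 0)
    then show ?thesis using 0 by auto
  next
    case (Suc k)
    define c where "c = 2 * b"
    \<comment> \<open>\<open>c\<close>, \<open>c + 1\<close> and \<open>c + 2\<close> bound the two halves of the heavy block \<open>b\<close>; if all three were bad,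
      one half would contain all but fewer than \<open>2 * \<sigma>\<close> entries.\<close>
    have div: "x div 2 ^ h = x div 2 ^ k div 2" for x :: nat by (simp add: Suc mult.commute flip: div_mult2_eq)
    have near: "\<sigma> \<le> size {#x \<in># M. x div 2 ^ k \<le> c' + 1 \<and> c' \<le> x div 2 ^ k + 2#}"
      if "c' \<in> {c, c + 1, c + 2}" for c'
      using that by (intro order_trans[OF less_imp_le[OF b]] size_filter_mset_mono) (auto simp: div c_def)
    have outside: "2 * \<sigma> \<le> size {#x \<in># M. x div 2 ^ k \<noteq> b'#}" for b'
      using block_count_bound[OF _ z(2), of k b'] size z Suc size_filter_mset_split[of "\<lambda>x. x div 2 ^ k = b'" M]
      by (simp add: block_count_def)
    have le: "y * 2 ^ k \<le> x \<longleftrightarrow> y \<le> x div 2 ^ k" for x y :: nat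
      by (simp add: less_eq_div_iff_mult_less_eq)
    have union: "size (filter_mset P M) \<le> size (filter_mset Q M) + size (filter_mset R M)"
      if "\<And>x. P x \<Longrightarrow> Q x \<or> R x" for P Q R
    proof -
      have "size (filter_mset P M) \<le> size (filter_mset (\<lambda>x. Q x \<or> R x) M)"
        using that by (intro size_filter_mset_mono) auto
      also have "\<dots> \<le> size (filter_mset Q M) + size (filter_mset R M)" by (induction M) auto
      finally show ?thesis .
    qed
    have "\<exists>c'\<in>{c, c + 1, c + 2}. \<sigma> \<le> depth_score M (c' * 2 ^ k)"
    proof (rule ccontr)
      assume "\<not> ?thesis"
      then have not: "depth_score M (c * 2 ^ k) < \<sigma>" "depth_score M ((c + 1) * 2 ^ k) < \<sigma>"
        "depth_score M ((c + 2) * 2 ^ k) < \<sigma>" by auto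
      \<comment> \<open>The heavy block lies between \<open>c * 2 ^ k\<close> and
        \<open>(c + 2) * 2 ^ k\<close>. Each end thus has more than \<open>\<sigma>\<close> entries
        on its inner side, so a low depth forces few entries on its outer side.\<close>
      have "\<sigma> < size {#x \<in># M. c * 2 ^ k \<le> x#}"
        using b by (rule less_le_trans) (intro size_filter_mset_mono, auto simp: le div c_def)
      then have l: "size {#x \<in># M. x \<le> c * 2 ^ k#} < \<sigma>" using not(1) by (auto simp: depth_score_def)
      have "\<sigma> < size {#x \<in># M. x \<le> (c + 2) * 2 ^ k#}"
      proof (rule less_le_trans[OF b], rule size_filter_mset_mono)
        fix x assume "x div 2 ^ h = b"
        then have "\<not> (c + 2) * 2 ^ k \<le> x" unfolding le by (auto simp: div c_def)
        then show "x \<le> (c + 2) * 2 ^ k" by simp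
      qed
      then have r: "size {#x \<in># M. (c + 2) * 2 ^ k \<le> x#} < \<sigma>" using not(3) by (auto simp: depth_score_def)
      consider "size {#x \<in># M. x \<le> (c + 1) * 2 ^ k#} < \<sigma>" | "size {#x \<in># M. (c + 1) * 2 ^ k \<le> x#} < \<sigma>"
        using not(2) by (auto simp: depth_score_def min_less_iff_disj)
      then show False
      proof cases
        case 1
        have "size {#x \<in># M. x div 2 ^ k \<noteq> c + 1#}
          \<le> size {#x \<in># M. x \<le> (c + 1) * 2 ^ k#} + size {#x \<in># M. (c + 2) * 2 ^ k \<le> x#}"
        proof (rule union)
          fix x assume "x div 2 ^ k \<noteq> c + 1"
          then have "\<not> (c + 1) * 2 ^ k \<le> x \<or> (c + 2) * 2 ^ k \<le> x" unfolding le by auto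
          then show "x \<le> (c + 1) * 2 ^ k \<or> (c + 2) * 2 ^ k \<le> x" by auto
        qed
        then show False using outside[of "c + 1"] 1 r by linarith
      next
        case 2
        have "size {#x \<in># M. x div 2 ^ k \<noteq> c#}
          \<le> size {#x \<in># M. x \<le> c * 2 ^ k#} + size {#x \<in># M. (c + 1) * 2 ^ k \<le> x#}"
        proof (rule union)
          fix x assume "x div 2 ^ k \<noteq> c"
          then have "\<not> c * 2 ^ k \<le> x \<or> (c + 1) * 2 ^ k \<le> x" unfolding le by auto
          then show "x \<le> c * 2 ^ k \<or> (c + 1) * 2 ^ k \<le> x" by auto
        qed
        then show False using outside[of c] 2 l by linarith
      qed
    qed
    then obtain c' where "c' \<in> {c, c + 1, c + 2}" "\<sigma> \<le> depth_score M (c' * 2 ^ k)" by blast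
    then have "\<sigma> \<le> boundary_score (h - 1) M c'" using near Suc by (simp add: boundary_score_def)
    then show ?thesis ..
  qed
qed

text \<open>Each of the \<open>K + 1\<close> selections is run with \<open>4 * n\<close> as
  candidate bound, which gives the factor 8. The induction generalises over the common part
  \<open>C\<close>, since condensing turns it into another common part; rescaling by
  \<open>2 ^ (z - 1)\<close> is post-processing.\<close>

lemma interior_point_pmf_private:
  assumes "0 \<le> \<epsilon>" "0 \<le> \<delta>" "8 * real n * exp (2 * \<epsilon>) \<le> \<delta> * exp (\<epsilon> * \<tau>)" "4 \<le> n"
    and "3 * \<sigma> * K \<le> size C" "size C < n"
  shows "measure_pmf.prob (interior_point_pmf \<epsilon> \<tau> \<sigma> K (add_mset x C)) T
    \<le> exp (real (Suc K) * (2 * \<epsilon>)) * measure_pmf.prob (interior_point_pmf \<epsilon> \<tau> \<sigma> K (add_mset x' C)) T + real (Suc K) * \<delta>"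
  using assms(5,6)
proof (induction K arbitrary: C x x' T)
  case 0
  show ?case
    using select_private[of "base_score (add_mset x C)" "4 * n" "base_score (add_mset x' C)" \<epsilon> \<delta> \<tau> T]
      base_score_support[OF assms(4)] base_score_swap assms(1,3) by simp
next
  case (Suc K)
  let ?c = "condense \<sigma> (2 * \<sigma>)"
  have C: "\<sigma> + 2 * \<sigma> \<le> size C" using Suc.prems by simp
  obtain y where y: "?c (add_mset x C) = add_mset y (?c C)" using condense_add_mset[OF C] by blast
  obtain y' where y': "?c (add_mset x' C) = add_mset y' (?c C)" using condense_add_mset[OF C] by blast
  have size: "3 * \<sigma> * K \<le> size (?c C)" "size (?c C) < n"
    using Suc.prems by (auto simp: size_condense algebra_simps)
  let ?f = "\<lambda>x z. map_pmf (\<lambda>c. c * 2 ^ (z - 1)) (select_pmf \<epsilon> \<tau> (boundary_score (z - 1) (add_mset x C)))"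
  have f: "measure_pmf.prob (?f x z) T \<le> exp (2 * \<epsilon>) * measure_pmf.prob (?f x' z) T + \<delta>" for z T
    unfolding measure_map_pmf using Suc.prems assms(1,3)
    by (intro select_private[of _ "4 * n"] boundary_score_support boundary_score_swap) auto
  have "real (Suc (Suc K)) * (2 * \<epsilon>) = real (Suc K) * (2 * \<epsilon>) + 2 * \<epsilon>"
    "real (Suc (Suc K)) * \<delta> = real (Suc K) * \<delta> + \<delta>" by (simp_all add: algebra_simps)
  then show ?case
    using prob_bind_le[OF Suc.IH[OF size, where x = y and x' = y'] f assms(2)]
    unfolding interior_point_pmf.simps y y' by simp
qed

section \<open>Domain growth and success probability of the recursion\<close>

text \<open>Entries below \<open>2 ^ d\<close> have heights at most \<open>d\<close> inclusive, so
  \<open>d = domain_bound K - 1\<close> keeps the heights strictly below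
  \<open>domain_bound K\<close>.\<close>

primrec domain_bound :: "nat \<Rightarrow> nat" where
  "domain_bound 0 = 16"
| "domain_bound (Suc K) = 2 ^ (domain_bound K - 1)"

lemma domain_bound_ge: "16 \<le> domain_bound K"
proof (induction K)
  case (Suc K)
  have "(2::nat) ^ 15 \<le> 2 ^ (domain_bound K - 1)" using Suc by (intro power_increasing) auto
  then show ?case by simp
qed simp

text \<open>A union bound over the \<open>K + 1\<close> selections. Each level uses up
  \<open>3 * \<sigma>\<close> entries and leaves \<open>2 * \<sigma>\<close> for the base
  case.\<close>

lemma interior_point_pmf_useful:
  assumes "0 \<le> \<epsilon>" "0 < \<sigma>" "exp (\<epsilon> * (\<tau> - real \<sigma>)) \<le> \<beta>" "\<beta> \<le> 1"
    and "size M = 3 * \<sigma> * K + 2 * \<sigma>" "\<And>x. x \<in># M \<Longrightarrow> x < domain_bound K"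
  shows "1 - real (Suc K) * \<beta> \<le> measure_pmf.prob (interior_point_pmf \<epsilon> \<tau> \<sigma> K M) (interior_points M)"
  using assms(5,6)
proof (induction K arbitrary: M)
  case 0
  obtain c where c: "\<sigma> \<le> base_score M c" using base_score_useful[of \<sigma> M] 0 assms(2) by auto
  have "1 - \<beta> \<le> 1 - exp (\<epsilon> * (\<tau> - real \<sigma>))" using assms by simp
  also have "\<dots> \<le> measure_pmf.prob (select_pmf \<epsilon> \<tau> (base_score M)) {c. 0 < base_score M c}"
    by (rule select_useful[OF base_score_support(1)[OF order_refl] c assms(2,1)])
  also have "\<dots> \<le> measure_pmf.prob (select_pmf \<epsilon> \<tau> (base_score M)) (interior_points M)"
    by (intro measure_pmf.finite_measure_mono) (auto simp: base_score_def interior_if_depth_score split: if_splits)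
  finally show ?case by simp
next
  case (Suc K)
  let ?M = "condense \<sigma> (2 * \<sigma>) M"
  have size: "3 * \<sigma> \<le> size M" using Suc.prems by simp
  have "y < domain_bound K" if "y \<in># ?M" for y
    using condense_le[of M "domain_bound K - 1" y] Suc.prems(2) that domain_bound_ge[of K] by fastforce
  moreover have "size ?M = 3 * \<sigma> * K + 2 * \<sigma>" using Suc.prems by (simp add: size_condense)
  ultimately have "1 - real (Suc K) * \<beta> \<le> measure_pmf.prob (interior_point_pmf \<epsilon> \<tau> \<sigma> K ?M) (interior_points ?M)"
    using Suc.IH by blast
  moreover have "1 - \<beta> \<le> measure_pmf.prob (map_pmf (\<lambda>c. c * 2 ^ (z - 1)) (select_pmf \<epsilon> \<tau> (boundary_score (z - 1) M))) (interior_points M)"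
    if z: "z \<in> interior_points ?M" for z
  proof -
    obtain c where c: "\<sigma> \<le> boundary_score (z - 1) M c"
      using boundary_score_useful[OF size, of _ _ z] z unfolding interior_points_def by blast
    have "1 - \<beta> \<le> 1 - exp (\<epsilon> * (\<tau> - real \<sigma>))" using assms by simp
    also have "\<dots> \<le> measure_pmf.prob (select_pmf \<epsilon> \<tau> (boundary_score (z - 1) M)) {c. 0 < boundary_score (z - 1) M c}"
      by (rule select_useful[OF boundary_score_support(1)[OF order_refl] c assms(2,1)])
    also have "\<dots> \<le> measure_pmf.prob (select_pmf \<epsilon> \<tau> (boundary_score (z - 1) M)) ((\<lambda>c. c * 2 ^ (z - 1)) -` interior_points M)"
      by (intro measure_pmf.finite_measure_mono) (auto simp: boundary_score_def interior_if_depth_score)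
    finally show ?thesis by simp
  qed
  moreover have "0 \<le> \<beta>" using assms(3) by (meson exp_ge_zero order_trans)
  ultimately have "1 - (real (Suc K) * \<beta> + \<beta>)
    \<le> measure_pmf.prob (interior_point_pmf \<epsilon> \<tau> \<sigma> (Suc K) M) (interior_points M)"
    unfolding interior_point_pmf.simps using assms(4) by (intro prob_bind_ge) auto
  then show ?case by (simp add: algebra_simps)
qed

section \<open>Sample complexity\<close>

text \<open>Shows that \<open>LEAST\<close> in \<open>log_star\<close> has a witness: since
  \<open>m + 1 \<le> 2 ^ m\<close>, each logarithm lowers an integer upper bound by at least
  one.\<close>

lemma log_star_le_one: "(log 2 ^^ log_star x) x \<le> 1"
proof -
  have "x \<le> real m \<Longrightarrow> \<exists>k. (log 2 ^^ k) x \<le> 1" for m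
  proof (induction m arbitrary: x)
    case 0
    then show ?case by (intro exI[of _ 0]) simp
  next
    case (Suc m)
    show ?case
    proof (cases "x \<le> 1")
      case True
      then show ?thesis by (intro exI[of _ 0]) simp
    next
      case False
      have "real (Suc m) \<le> 2 ^ m"
        by (metis Suc_leI less_exp of_nat_le_iff of_nat_numeral of_nat_power)
      then have "x \<le> 2 powr real m" using Suc.prems by (simp add: powr_realpow)
      then have "log 2 x \<le> real m" using False by (simp add: log_le_iff)
      then obtain k where "(log 2 ^^ k) (log 2 x) \<le> 1" using Suc.IH by blast
      then have "(log 2 ^^ Suc k) x \<le> 1" by (simp only: funpow_Suc_right o_apply)
      then show ?thesis by blast
    qed
  qed
  then have "\<exists>k. (log 2 ^^ k) x \<le> 1" using real_arch_simple by blast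
  then show ?thesis unfolding log_star_def by (rule LeastI_ex)
qed

text \<open>The spare factor 2 pays for the \<open>- 1\<close> in the exponent of
  \<open>domain_bound\<close>: half of a number that is at least 16 is at most that number minus
  2.\<close>

lemma le_domain_bound:
  "(log 2 ^^ K) x \<le> 1 \<Longrightarrow> x \<le> real (domain_bound K) / 2"
proof (induction K arbitrary: x)
  case (Suc K)
  have "log 2 x \<le> real (domain_bound K) / 2"
    using Suc by (simp only: funpow_Suc_right o_apply)
  also have "\<dots> \<le> real (domain_bound K - 2)" using domain_bound_ge[of K] by simp
  finally have *: "log 2 x \<le> real (domain_bound K - 2)" .
  have suc: "domain_bound K - 1 = Suc (domain_bound K - 2)" using domain_bound_ge[of K] by simp
  show ?case
  proof (cases "0 < x")
    case True
    then have "x \<le> 2 powr real (domain_bound K - 2)" using * by (simp add: log_le_iff)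
    then show ?thesis unfolding domain_bound.simps suc by (simp add: powr_realpow)
  next
    case False
    then have "x \<le> 0" by simp
    also have "0 \<le> real (domain_bound (Suc K)) / 2" by simp
    finally show ?thesis .
  qed
qed simp

section \<open>Transfer to finite linear orders\<close>

lemma neighboringE:
  assumes "neighboring S S'"
  obtains i where "i < length S" "length S' = length S" "S ! i \<noteq> S' ! i" "S' = S[i := S' ! i]"
proof -
  obtain i where i: "{i. i < length S \<and> S ! i \<noteq> S' ! i} = {i}"
    using assms unfolding neighboring_def by (metis card_1_singletonE)
  have len: "length S' = length S" using assms by (simp add: neighboring_def)
  have "i \<in> {i. i < length S \<and> S ! i \<noteq> S' ! i}" unfolding i by simp
  then have il: "i < length S" "S ! i \<noteq> S' ! i" by simp_all
  have "S ! j = S' ! j" if "j < length S" "j \<noteq> i" for j using i that by blast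
  then have "S' ! j = S[i := S' ! i] ! j" if "j < length S'" for j
    using that il len by (cases "j = i") auto
  then have "S' = S[i := S' ! i]" using len by (intro nth_equalityI) simp_all
  then show thesis using that il len by blast
qed

lemma neighboring_mset:
  assumes "neighboring S S'"
  obtains x x' C where "mset S = add_mset x C" "mset S' = add_mset x' C"
proof -
  obtain i where i: "i < length S" "S' = S[i := S' ! i]" using assms by (rule neighboringE)
  then have "mset S' = add_mset (S' ! i) (mset S - {#S ! i#})" using mset_update by metis
  moreover have "mset S = add_mset (S ! i) (mset S - {#S ! i#})" using i by simp
  ultimately show thesis using that by blast
qed

text \<open>Entries are replaced by their ranks in \<open>X\<close>, which preserves the order;
  decoding the output is post-processing.\<close>

lemma exists_algorithm_of_nat_algorithm:
  fixes X :: "'a::linorder set" and B :: "nat multiset \<Rightarrow> nat pmf"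
  assumes X: "finite X" "X \<noteq> {}" and "0 < n"
    and priv: "\<And>x x' C T. size C = n - 1 \<Longrightarrow>
      measure_pmf.prob (B (add_mset x C)) T \<le> exp \<epsilon> * measure_pmf.prob (B (add_mset x' C)) T + \<delta>"
    and useful: "\<And>M. size M = n \<Longrightarrow> (\<And>x. x \<in># M \<Longrightarrow> x < card X) \<Longrightarrow>
      1 - \<beta> \<le> measure_pmf.prob (B M) (interior_points M)"
  shows "\<exists>\<A> :: 'a list \<Rightarrow> 'a pmf. randomized_algorithm X n \<A> \<and> differentially_private X n \<epsilon> \<delta> \<A> \<and>
    solves_interior_point X n \<beta> \<A>"
proof -
  define l where "l = sorted_list_of_set X"
  have l: "sorted l" "set l = X" "length l = card X" using X by (simp_all add: l_def)
  define r where "r x = (SOME i. i < card X \<and> l ! i = x)" for x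
  have r: "r x < card X" "l ! r x = x" if "x \<in> X" for x
    using someI_ex[of "\<lambda>i. i < card X \<and> l ! i = x"] that l unfolding r_def by (auto simp: in_set_conv_nth)
  have pos: "0 < card X" using X by (simp add: card_gt_0_iff)
  \<comment> \<open>Outputs are clamped to the last rank, so even a failed run returns an element of
    \<open>X\<close>. Interior points are valid ranks and are unaffected.\<close>
  define f where "f p = l ! min p (card X - 1)" for p
  have fX: "f p \<in> X" for p
    using l pos nth_mem[of "min p (card X - 1)" l] by (auto simp: f_def)
  define \<A> where "\<A> S = map_pmf f (B (mset (map r S)))" for S
  have "differentially_private X n \<epsilon> \<delta> \<A>"
    unfolding differentially_private_def
  proof (intro ballI impI allI)
    fix S S' T assume S: "S \<in> databases X n" "neighboring S S'"
    obtain x x' C where C: "mset S = add_mset x C" "mset S' = add_mset x' C"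
      using S(2) by (rule neighboring_mset)
    have "size (mset S) = n" using S(1) by (simp add: databases_def)
    then have "size (image_mset r C) = n - 1" using C by simp
    then show "measure_pmf.prob (\<A> S) T \<le> exp \<epsilon> * measure_pmf.prob (\<A> S') T + \<delta>"
      using priv by (simp add: \<A>_def C)
  qed
  moreover have "solves_interior_point X n \<beta> \<A>"
    unfolding solves_interior_point_def
  proof
    fix S assume S: "S \<in> databases X n"
    then have SX: "set S \<subseteq> X" and "length S = n" by (auto simp: databases_def)
    then have "1 - \<beta> \<le> measure_pmf.prob (B (mset (map r S))) (interior_points (mset (map r S)))"
      using r by (intro useful) auto
    also have "\<dots> \<le> measure_pmf.prob (B (mset (map r S))) (f -` {y. Min (set S) \<le> y \<and> y \<le> Max (set S)})"
    proof (rule measure_pmf.finite_measure_mono)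
      show "interior_points (mset (map r S)) \<subseteq> f -` {y. Min (set S) \<le> y \<and> y \<le> Max (set S)}"
      proof
        fix p assume "p \<in> interior_points (mset (map r S))"
        then obtain x x' where x: "x \<in> set S" "r x \<le> p" "x' \<in> set S" "p \<le> r x'"
          by (auto simp: interior_points_def)
        have p: "p < card X" using x SX r(1)[of x'] by auto
        then have "min p (card X - 1) = p" by simp
        then have f: "f p = l ! p" by (simp add: f_def)
        have "Min (set S) \<le> x" using x by simp
        also have "x = l ! r x" using x SX r by auto
        also have "\<dots> \<le> l ! p" using l x p by (intro sorted_nth_mono) auto
        finally have 1: "Min (set S) \<le> f p" by (simp add: f)
        have "l ! p \<le> l ! r x'" using l x SX r(1)[of x'] by (intro sorted_nth_mono) auto
        also have "\<dots> = x'" using x SX r by auto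
        also have "x' \<le> Max (set S)" using x by simp
        finally show "p \<in> f -` {y. Min (set S) \<le> y \<and> y \<le> Max (set S)}" using 1 by (simp add: f)
      qed
    qed simp
    finally show "1 - \<beta> \<le> measure_pmf.prob (\<A> S) {y. Min (set S) \<le> y \<and> y \<le> Max (set S)}"
      by (simp add: \<A>_def)
  qed
  ultimately show ?thesis using fX by (intro exI[of _ \<A>]) (auto simp: randomized_algorithm_def \<A>_def)
qed

section \<open>Choice of parameters and the final bound\<close>

lemma exists_algorithm_log_star:
  fixes X :: "'a::linorder set"
  defines "J \<equiv> real (log_star (real (card X))) + 1"
  assumes X: "finite X" "X \<noteq> {}" and \<epsilon>: "0 < \<epsilon>" and \<delta>: "0 < \<delta>" "\<delta> < 1"
  shows "\<exists>n>0. real n \<le> 24 * J\<^sup>2 * ln (576 * J ^ 3 / (min \<epsilon> 1 * \<delta>)) / min \<epsilon> 1 \<and>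
    (\<exists>\<A> :: 'a list \<Rightarrow> 'a pmf. randomized_algorithm X n \<A> \<and> differentially_private X n \<epsilon> \<delta> \<A> \<and>
      solves_interior_point X n (1 / 10) \<A>)"
proof -
  define K where "K = log_star (real (card X))"
  define \<epsilon>' where "\<epsilon>' = min \<epsilon> 1"
  \<comment> \<open>Each of the \<open>J\<close> levels costs \<open>2 * e\<close>, adding up to
    \<open>\<epsilon>'\<close>. Then \<open>exp (e * \<tau>) = m * m\<close>, and
    \<open>\<sigma>\<close> exceeds \<open>\<tau>\<close> by at least \<open>ln m / e\<close>, so
    that a level fails with probability at most \<open>1 / m\<close>. The constant is
    \<open>576 = 8 * 3 * 24\<close>: the 8 of the privacy condition, the bound 3 on
    \<open>exp (2 * e)\<close> and the 24 in the bound on \<open>n\<close>.\<close>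
  define e where "e = \<epsilon>' / (2 * J)"
  define m where "m = 576 * J ^ 3 / (\<epsilon>' * \<delta>)"
  define \<tau> where "\<tau> = 2 * ln m / e"
  define \<sigma> where "\<sigma> = nat \<lceil>3 * ln m / e\<rceil>"
  define n where "n = 3 * \<sigma> * K + 2 * \<sigma>"
  have J: "J = real (Suc K)" "1 \<le> J" by (simp_all add: J_def K_def)
  have \<epsilon>': "0 < \<epsilon>'" "\<epsilon>' \<le> 1" "\<epsilon>' \<le> \<epsilon>" using \<epsilon> by (simp_all add: \<epsilon>'_def)
  have e: "0 < e" "e \<le> 1" "2 * e * J = \<epsilon>'" "2 * e \<le> 1"
    using J \<epsilon>' by (simp_all add: e_def field_simps)
  have "J \<le> J ^ 3" using J(2) by (simp add: self_le_power)
  moreover have "0 < \<epsilon>' * \<delta>" "\<epsilon>' * \<delta> \<le> 1" using \<epsilon>' \<delta> by (simp_all add: mult_le_one)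
  ultimately have m: "576 * J \<le> m" unfolding m_def by (simp add: le_divide_eq mult_mono' mult_le_one)
      (smt (verit) J(2) mult_left_le)
  then have m3: "3 \<le> m" "0 < m" using J by linarith+
  then have "exp 1 \<le> m" using exp_le by linarith
  then have ln1: "1 \<le> ln m" using m3 by (simp add: ln_ge_iff)
  have lnm: "ln m \<le> m" using ln_bound m3 by simp
  have le1: "1 \<le> ln m / e" using ln1 e by (simp add: le_divide_eq)
  \<comment> \<open>The rounding error is below 1, hence below \<open>ln m / e\<close>.\<close>
  have \<sigma>: "3 * ln m / e \<le> real \<sigma>" "real \<sigma> \<le> 4 * ln m / e"
    using le1 unfolding \<sigma>_def by linarith+
  have \<sigma>3: "3 \<le> \<sigma>" using \<sigma>(1) le1 by linarith
  have "real n \<le> 3 * J * real \<sigma>" by (simp add: n_def J algebra_simps)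
  also have "\<dots> \<le> 3 * J * (4 * ln m / e)" using J \<sigma> by (intro mult_left_mono) auto
  also have "\<dots> = 24 * J\<^sup>2 * ln m / \<epsilon>'" using J \<epsilon>' by (simp add: e_def power2_eq_square field_simps)
  finally have n_le: "real n \<le> 24 * J\<^sup>2 * ln m / \<epsilon>'" .
  have "exp (2 * e) \<le> 3" using e(4) exp_le by (smt (verit) exp_le_cancel_iff)
  then have "8 * real n * exp (2 * e) \<le> 8 * real n * 3" by (intro mult_left_mono) auto
  also have "\<dots> \<le> 24 * (24 * J\<^sup>2 * ln m / \<epsilon>')" using n_le by simp
  \<comment> \<open>Bounding \<open>ln m\<close> by \<open>m\<close> is affordable: one factor of
    \<open>m * m\<close> absorbs it, the other cancels the constants, \<open>J\<close>,
    \<open>\<epsilon>'\<close> and \<open>\<delta>\<close>.\<close>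
  also have "\<dots> \<le> 24 * (24 * J\<^sup>2 * m / \<epsilon>')" using lnm \<epsilon>' J by (simp add: divide_right_mono mult_left_mono)
  also have "\<dots> = \<delta> / J * (m * m)"
  proof -
    have "\<delta> / J * m = 576 * J\<^sup>2 / \<epsilon>'"
      using J(2) \<epsilon>' \<delta> by (simp add: m_def field_simps power2_eq_square power3_eq_cube)
    then show ?thesis by (simp flip: mult.assoc)
  qed
  also have "m * m = exp (e * \<tau>)" using e m3 by (simp add: \<tau>_def exp_double power2_eq_square flip: exp_add)
  finally have fits: "8 * real n * exp (2 * e) \<le> \<delta> / J * exp (e * \<tau>)" by (simp add: mult.assoc)
  have "e * (\<tau> - real \<sigma>) \<le> - ln m" using \<sigma>(1) e by (simp add: \<tau>_def field_simps)
  then have "exp (e * (\<tau> - real \<sigma>)) \<le> exp (- ln m)" by simp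
  also have "\<dots> = 1 / m" using m3 by (simp add: exp_minus inverse_eq_divide)
  also have "\<dots> \<le> 1 / (10 * J)" using m J by (intro divide_left_mono) auto
  finally have fail: "exp (e * (\<tau> - real \<sigma>)) \<le> 1 / (10 * J)" .
  have "real (card X) \<le> real (domain_bound K) / 2"
    unfolding K_def by (rule le_domain_bound[OF log_star_le_one])
  then have dom: "card X \<le> domain_bound K" by linarith
  have "\<exists>\<A> :: 'a list \<Rightarrow> 'a pmf. randomized_algorithm X n \<A> \<and> differentially_private X n \<epsilon> \<delta> \<A> \<and>
      solves_interior_point X n (1 / 10) \<A>"
  proof (rule exists_algorithm_of_nat_algorithm[OF X])
    show "0 < n" using \<sigma>3 by (simp add: n_def)
  next
    fix x x' T and C :: "nat multiset" assume C: "size C = n - 1"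
    have "measure_pmf.prob (interior_point_pmf e \<tau> \<sigma> K (add_mset x C)) T
      \<le> exp (real (Suc K) * (2 * e)) * measure_pmf.prob (interior_point_pmf e \<tau> \<sigma> K (add_mset x' C)) T
        + real (Suc K) * (\<delta> / J)"
      using fits \<sigma>3 e \<delta> J C by (intro interior_point_pmf_private[where n = n]) (auto simp: n_def)
    also have "real (Suc K) * (2 * e) = \<epsilon>'" using e(3) J by (simp add: mult_ac)
    also have "real (Suc K) * (\<delta> / J) = \<delta>" using J by simp
    also have "exp \<epsilon>' * measure_pmf.prob (interior_point_pmf e \<tau> \<sigma> K (add_mset x' C)) T
      \<le> exp \<epsilon> * measure_pmf.prob (interior_point_pmf e \<tau> \<sigma> K (add_mset x' C)) T"
      using \<epsilon>' by (intro mult_right_mono) auto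
    finally show "measure_pmf.prob (interior_point_pmf e \<tau> \<sigma> K (add_mset x C)) T
      \<le> exp \<epsilon> * measure_pmf.prob (interior_point_pmf e \<tau> \<sigma> K (add_mset x' C)) T + \<delta>" by simp
  next
    fix M :: "nat multiset" assume M: "size M = n" "\<And>x. x \<in># M \<Longrightarrow> x < card X"
    have "1 - real (Suc K) * (1 / (10 * J)) \<le> measure_pmf.prob (interior_point_pmf e \<tau> \<sigma> K M) (interior_points M)"
    proof (rule interior_point_pmf_useful[OF _ _ fail])
      show "x < domain_bound K" if "x \<in># M" for x using M(2)[OF that] dom by simp
    qed (use e \<sigma>3 J M in \<open>auto simp: n_def\<close>)
    moreover have "real (Suc K) * (1 / (10 * J)) = 1 / 10" unfolding J(1)[symmetric] using J(2) by simp
    ultimately show "1 - 1 / 10 \<le> measure_pmf.prob (interior_point_pmf e \<tau> \<sigma> K M) (interior_points M)"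
      by argo
  qed
  moreover have "0 < n" using \<sigma>3 by (simp add: n_def)
  ultimately show ?thesis using n_le unfolding m_def \<epsilon>'_def by blast
qed

text \<open>Outputs one of two entries uniformly. Changing one entry affects an event by at most
  1/2, and with at most one domain element there are no neighbours. This covers the cases where
  \<open>ln (1 / \<delta>)\<close> or \<open>log_star\<close> may be close to 0.\<close>

lemma exists_algorithm_two_samples:
  fixes X :: "'a::linorder set"
  assumes "finite X" "card X \<le> 1 \<or> 1 / 2 \<le> \<delta>" "0 < \<epsilon>" "0 < \<delta>"
  shows "\<exists>\<A> :: 'a list \<Rightarrow> 'a pmf. randomized_algorithm X 2 \<A> \<and> differentially_private X 2 \<epsilon> \<delta> \<A> \<and>
    solves_interior_point X 2 (1 / 10) \<A>"
proof -
  define \<A> :: "'a list \<Rightarrow> 'a pmf" where "\<A> S = map_pmf ((!) S) (pmf_of_set {0, 1})" for S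
  have supp: "set_pmf (\<A> S) \<subseteq> set S" if "S \<in> databases X 2" for S
    using that by (auto simp: \<A>_def databases_def)
  have "differentially_private X 2 \<epsilon> \<delta> \<A>"
    unfolding differentially_private_def
  proof (intro ballI impI allI)
    fix S S' T assume S: "S \<in> databases X 2" "S' \<in> databases X 2" "neighboring S S'"
    obtain i where i: "i < length S" "S ! i \<noteq> S' ! i" "S' = S[i := S' ! i]"
      using S(3) by (rule neighboringE)
    have len: "length S = 2" "length S' = 2" using S by (auto simp: databases_def)
    have "S ! i \<in> X" "S' ! i \<in> X"
      using i(1) S len nth_mem[of i S] nth_mem[of i S'] by (auto simp: databases_def)
    then have "\<not> card X \<le> 1" using assms(1) i(2) by (metis card_le_Suc0_iff_eq One_nat_def)
    then have \<delta>: "1 / 2 \<le> \<delta>" using assms by blast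
    have half: "measure_pmf.prob (\<A> R) T = (indicator T (R ! 0) + indicator T (R ! 1)) / 2" for R
      unfolding \<A>_def measure_map_pmf
      by (subst measure_pmf_of_set) (auto simp: indicator_def Int_insert_left)
    have "measure_pmf.prob (\<A> S) T \<le> measure_pmf.prob (\<A> S') T + 1 / 2"
    proof -
      have "S ! j = S' ! j" if "j \<noteq> i" for j using i(3) that by (metis nth_list_update_neq)
      moreover have "i = 0 \<or> i = 1" using i(1) len by auto
      ultimately show ?thesis unfolding half by (auto simp: indicator_def)
    qed
    also have "\<dots> \<le> exp \<epsilon> * measure_pmf.prob (\<A> S') T + \<delta>"
      using \<delta> assms(3) by (intro add_mono) (auto simp: mult_le_cancel_right1)
    finally show "measure_pmf.prob (\<A> S) T \<le> exp \<epsilon> * measure_pmf.prob (\<A> S') T + \<delta>" .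
  qed
  moreover have "solves_interior_point X 2 (1 / 10) \<A>"
    unfolding solves_interior_point_def
  proof
    fix S assume "S \<in> databases X 2"
    then have "set_pmf (\<A> S) \<subseteq> {y. Min (set S) \<le> y \<and> y \<le> Max (set S)}" using supp by fastforce
    then have "measure_pmf.prob (\<A> S) {y. Min (set S) \<le> y \<and> y \<le> Max (set S)} = 1"
      by (subst measure_pmf.prob_eq_1) (auto simp: AE_measure_pmf_iff)
    then show "1 - 1 / 10 \<le> measure_pmf.prob (\<A> S) {y. Min (set S) \<le> y \<and> y \<le> Max (set S)}" by simp
  qed
  moreover have "randomized_algorithm X 2 \<A>"
    using supp by (fastforce simp: randomized_algorithm_def databases_def)
  ultimately show ?thesis by blast
qed

text \<open>The upper bound \<open>E\<close> on \<open>\<epsilon>\<close> allows replacing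
  \<open>1 / min \<epsilon> 1\<close> by \<open>E / \<epsilon>\<close>. Outside the two-sample cases
  \<open>log_star\<close> is at least 1 and \<open>ln (1 / \<delta>)\<close> at least 1/2, so every
  remaining factor is controlled by \<open>G\<close>.\<close>

lemma exists_algorithm_soft_bound:
  fixes X :: "'a::linorder set" and \<epsilon> \<delta> E :: real
  defines "G \<equiv> max 1 (1 / \<epsilon> * ln (1 / \<delta>) * real (log_star (real (card X))) ^ 2)"
    and "C \<equiv> 96 * E * (2 * ln (18432 * E\<^sup>2) + 5)"
  assumes X: "finite X" and \<epsilon>: "0 < \<epsilon>" "\<epsilon> \<le> E" and E: "1 \<le> E" and \<delta>: "0 < \<delta>" "\<delta> < 1"
  shows "\<exists>n>0. real n \<le> C * (G * (1 + ln G)) \<and>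
    (\<exists>\<A> :: 'a list \<Rightarrow> 'a pmf. randomized_algorithm X n \<A> \<and> differentially_private X n \<epsilon> \<delta> \<A> \<and>
      solves_interior_point X n (1 / 10) \<A>)"
proof -
  define C0 where "C0 = ln (18432 * E\<^sup>2)"
  have E2: "1 \<le> E\<^sup>2" using E by simp
  then have C0: "0 \<le> C0" by (simp add: C0_def)
  have G: "1 \<le> G" "0 \<le> ln G" by (simp_all add: G_def)
  have "96 * 1 * (2 * 0 + 5) \<le> C" unfolding C_def using C0[unfolded C0_def] E by (intro mult_mono) auto
  then have C: "2 \<le> C" by simp
  show ?thesis
  proof (cases "card X \<le> 1 \<or> 1 / 2 \<le> \<delta>")
    case True
    have "2 * 1 \<le> C * (G * (1 + ln G))"
      using C G mult_mono[of 1 G 1 "1 + ln G"] by (intro mult_mono) auto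
    then show ?thesis using exists_algorithm_two_samples[OF X True \<epsilon>(1) \<delta>(1)] by (intro exI[of _ 2]) auto
  next
    case False
    define K where "K = real (log_star (real (card X)))"
    have "log_star (real (card X)) \<noteq> 0"
    proof
      assume "log_star (real (card X)) = 0"
      then show False using log_star_le_one[of "real (card X)"] False by simp
    qed
    then have K: "1 \<le> K" by (simp add: K_def)
    define a where "a = ln (1 / \<delta>)"
    have "ln 2 \<le> a" using False \<delta> by (simp add: a_def field_simps)
    then have a: "1 / 2 \<le> a" using ln2_ge_two_thirds by linarith
    define q where "q = K\<^sup>2 / \<epsilon>"
    have q0: "0 < q" using K \<epsilon> by (simp add: q_def)
    have qa: "q * a \<le> G" by (simp add: G_def q_def a_def K_def mult_ac)
    have "q * (1 / 2) \<le> q * a" using a q0 by (intro mult_left_mono) auto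
    then have q: "q \<le> 2 * G" using qa by linarith
    \<comment> \<open>Bounds \<open>K\<close> itself linearly in \<open>G\<close>, so that the
      powers of \<open>K\<close> inside \<open>ln m\<close> cost only a multiple of
      \<open>ln G\<close>.\<close>
    have "K \<le> K\<^sup>2" using K by (simp add: self_le_power)
    also have "\<dots> = \<epsilon> * q" using \<epsilon> by (simp add: q_def)
    also have "\<dots> \<le> E * (2 * G)" using \<epsilon> q q0 E by (intro mult_mono) auto
    finally have KG: "K \<le> E * (2 * G)" .
    define J where "J = K + 1"
    define \<epsilon>' where "\<epsilon>' = min \<epsilon> 1"
    have J: "1 \<le> J" "J \<le> 2 * K" using K by (simp_all add: J_def)
    have "\<epsilon> \<le> E * \<epsilon>'" using \<epsilon> E by (simp add: \<epsilon>'_def min_def)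
    moreover have \<epsilon>': "0 < \<epsilon>'" using \<epsilon> by (simp add: \<epsilon>'_def)
    ultimately have inv: "1 / \<epsilon>' \<le> E / \<epsilon>" using \<epsilon> by (simp add: field_simps)
    define m where "m = 576 * J ^ 3 / (\<epsilon>' * \<delta>)"
    have m0: "0 < m" using J \<epsilon>' \<delta> by (simp add: m_def)
    have "m = 576 * J ^ 3 * (1 / \<epsilon>') * (1 / \<delta>)" by (simp add: m_def)
    also have "\<dots> \<le> 576 * (2 * K) ^ 3 * (E / \<epsilon>) * (1 / \<delta>)"
      using J \<epsilon>' \<epsilon> E \<delta> inv K by (intro mult_mono power_mono) auto
    also have "\<dots> = 4608 * E * q * K * (1 / \<delta>)"
      by (simp add: q_def power2_eq_square power3_eq_cube)
    also have "\<dots> \<le> 4608 * E * (2 * G) * (E * (2 * G)) * (1 / \<delta>)"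
      using E q KG q0 G K \<delta> by (intro mult_mono) auto
    also have "\<dots> = (18432 * E\<^sup>2) * G\<^sup>2 * (1 / \<delta>)" by (simp add: power2_eq_square)
    finally have "ln m \<le> ln ((18432 * E\<^sup>2) * G\<^sup>2 * (1 / \<delta>))" using m0 by simp
    also have "\<dots> = C0 + 2 * ln G + a"
      using E G \<delta> by (simp add: C0_def a_def ln_mult ln_realpow ln_div)
    \<comment> \<open>As \<open>a\<close> is at least 1/2, \<open>C0\<close> is at most
      \<open>2 * a * C0\<close> and \<open>2 * ln G\<close> at most \<open>4 * a * ln G\<close>;
      this pulls out the factor \<open>a\<close> needed to form \<open>q * a\<close>.\<close>
    also have "\<dots> \<le> a * ((2 * C0 + 5) * (1 + ln G))"
    proof -
      have "1 / 2 * C0 \<le> a * C0" "1 / 2 * ln G \<le> a * ln G"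
        using a C0 G by (intro mult_right_mono; simp)+
      moreover have "0 \<le> a * (C0 * ln G)" "0 \<le> a * ln G" using a C0 G by auto
      ultimately show ?thesis using a by (simp add: algebra_simps)
    qed
    finally have lnm: "ln m \<le> a * ((2 * C0 + 5) * (1 + ln G))" .
    have "24 * J\<^sup>2 * ln m / \<epsilon>' \<le> 24 * J\<^sup>2 * (a * ((2 * C0 + 5) * (1 + ln G))) * (1 / \<epsilon>')"
      using lnm \<epsilon>' by (simp add: divide_right_mono mult_left_mono)
    also have "\<dots> \<le> 24 * (2 * K)\<^sup>2 * (a * ((2 * C0 + 5) * (1 + ln G))) * (E / \<epsilon>)"
      using J a C0 G inv \<epsilon>' by (intro mult_mono power_mono) auto
    also have "\<dots> = (96 * E * (2 * C0 + 5)) * ((q * a) * (1 + ln G))"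
      by (simp add: q_def power2_eq_square)
    also have "\<dots> \<le> (96 * E * (2 * C0 + 5)) * (G * (1 + ln G))"
      using qa E C0 G by (intro mult_left_mono mult_right_mono) auto
    finally have "24 * J\<^sup>2 * ln m / \<epsilon>' \<le> C * (G * (1 + ln G))" by (simp add: C_def C0_def)
    moreover have "X \<noteq> {}" using False by auto
    ultimately show ?thesis
      using exists_algorithm_log_star[OF X _ \<epsilon>(1) \<delta>] unfolding J_def K_def m_def \<epsilon>'_def
      by (meson order_trans)
  qed
qed

theorem theorem1p2:
  fixes \<epsilon>\<^sub>0 :: real
  defines "P \<equiv> {(X :: 'a::linorder set, \<epsilon> :: real, \<delta> :: real).
                  finite X \<and> 0 < \<epsilon> \<and> \<epsilon> \<le> \<epsilon>\<^sub>0 \<and> 0 < \<delta> \<and> \<delta> < 1}"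
  shows "\<exists>n :: 'a set \<times> real \<times> real \<Rightarrow> nat.
           (\<lambda>p. real (n p)) \<in>
             soft_O P (\<lambda>(X, \<epsilon>, \<delta>). 1 / \<epsilon> * ln (1 / \<delta>) * real (log_star (real (card X))) ^ 2) \<and>
           (\<forall>(X, \<epsilon>, \<delta>)\<in>P. n (X, \<epsilon>, \<delta>) > 0 \<and>
              (\<exists>\<A> :: 'a list \<Rightarrow> 'a pmf.
                 randomized_algorithm X (n (X, \<epsilon>, \<delta>)) \<A> \<and>
                 differentially_private X (n (X, \<epsilon>, \<delta>)) \<epsilon> \<delta> \<A> \<and>
                 solves_interior_point X (n (X, \<epsilon>, \<delta>)) (1 / 10) \<A>))"
proof -
  define g where "g = (\<lambda>(X :: 'a set, \<epsilon>, \<delta>). 1 / \<epsilon> * ln (1 / \<delta>) * real (log_star (real (card X))) ^ 2)"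
  \<comment> \<open>The maximum with 1 meets the requirement \<open>1 \<le> E\<close> also for small
    \<open>\<epsilon>\<^sub>0\<close>; \<open>C\<close> then depends on
    \<open>\<epsilon>\<^sub>0\<close> only, as uniformity over \<open>P\<close> demands.\<close>
  define E where "E = max 1 \<epsilon>\<^sub>0"
  define C where "C = 96 * E * (2 * ln (18432 * E\<^sup>2) + 5)"
  let ?G = "\<lambda>p. max 1 (g p) * (1 + ln (max 1 (g p)))"
  let ?Q = "\<lambda>(X, \<epsilon>, \<delta>) n. n > 0 \<and> (\<exists>\<A> :: 'a list \<Rightarrow> 'a pmf.
    randomized_algorithm X n \<A> \<and> differentially_private X n \<epsilon> \<delta> \<A> \<and> solves_interior_point X n (1 / 10) \<A>)"
  have "\<forall>p\<in>P. \<exists>n. real n \<le> C * ?G p \<and> ?Q p n"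
  proof
    fix p assume "p \<in> P"
    then obtain X \<epsilon> \<delta> where p: "p = (X, \<epsilon>, \<delta>)" "finite X" "0 < \<epsilon>" "\<epsilon> \<le> E" "0 < \<delta>" "\<delta> < 1"
      by (auto simp: P_def E_def)
    show "\<exists>n. real n \<le> C * ?G p \<and> ?Q p n"
      using exists_algorithm_soft_bound[OF p(2,3,4) _ p(5,6)] by (auto simp: p(1) g_def C_def E_def)
  qed
  then obtain n where "\<forall>p\<in>P. real (n p) \<le> C * ?G p \<and> ?Q p (n p)"
    by (auto dest: bchoice)
  then have n: "\<And>p. p \<in> P \<Longrightarrow> real (n p) \<le> C * ?G p" "\<And>p. p \<in> P \<Longrightarrow> ?Q p (n p)"
    by blast+
  \<comment> \<open>A single logarithmic factor suffices, so the exponent in \<open>soft_O\<close>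
    is 1.\<close>
  have "(\<lambda>p. real (n p)) \<in> O[principal P](\<lambda>p. max 1 (g p) * (1 + ln (max 1 (g p))) ^ 1)"
    using n(1) by (intro bigoI[of _ C]) (auto simp: eventually_principal abs_mult)
  then have "(\<lambda>p. real (n p)) \<in> soft_O P g" unfolding soft_O_def by blast
  moreover have "\<forall>(X, \<epsilon>, \<delta>)\<in>P. ?Q (X, \<epsilon>, \<delta>) (n (X, \<epsilon>, \<delta>))" using n(2) by blast
  ultimately show ?thesis unfolding g_def by (intro exI[of _ n]) simp
qed

end
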